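(* Let $n\ge 3$ and $2\le K\le n-1$. Then the inequalities $X_{ij}\ge 0$, for all $1\le i<j\le n$, define facets of $\mathrm{RCut}^K_n$ if and only if $K\ge 3$. Likewise, if $n\ge 4$ and $2\le K\le n-1$, the inequalities $X_{ij}\ge 0$, for all $1\le i<j\le n$, define facets of $\mathrm{RCut}^{=K}_n$ if and only if $K\ge 3$.
   Context: $[n]=\{1,\dots,n\}$. For a partition $\{\Gamma_k\}_{k=1}^K$ of $[n]$ (pairwise disjoint sets with union $[n]$, some possibly empty), the associated ratio-cut vector $X\in\mathbb{R}^{\binom n2}$ has entries, for $1\le i<j\le n$, $X_{ij}=\frac{1}{|\Gamma_k|}$ if $i$ and $j$ both belong to $\Gamma_k$ for some $k$, and $X_{ij}=0$ if $i,j$ belong to different sets of the partition. The ratio-cut polytope $\mathrm{RCut}^K_n\subset\mathbb{R}^{\binom n2}$ is the convex hull of all ratio-cut vectors corresponding to at most $K$ nonempty clusters. $\mathrm{RCut}^{=K}_n$ is the convex hull of all ratio-cut vectors corresponding to exactly $K$ nonempty clusters. A valid inequality defines a facet of a polytope $P$ if the set of points of $P$ satisfying it with equality has dimension $\dim(P)-1$. *)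

theory Defs
  imports "HOL-Analysis.Analysis" "HOL-Library.Disjoint_Sets"
begin

text \<open>
  The space of vectors indexed by the pairs \<open>1 \<le> i < j \<le> n\<close> is rendered as \<open>real ^ 'e\<close>, where
  a bijection \<open>p\<close> from the finite index type \<open>'e\<close> onto the set of these pairs names the
  coordinates: if \<open>p e = (i, j)\<close>, then \<open>X $ e\<close> is the entry \<open>X\<^sub>i\<^sub>j\<close>.
\<close>

definition pairs :: "nat \<Rightarrow> (nat \<times> nat) set" where
  "pairs n = {(i, j). 1 \<le> i \<and> i < j \<and> j \<le> n}"

definition pair_labelling :: "nat \<Rightarrow> ('e::finite \<Rightarrow> nat \<times> nat) \<Rightarrow> bool" where
  "pair_labelling n p \<longleftrightarrow> bij_betw p UNIV (pairs n)"

text \<open>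
  A partition is the set \<open>P\<close> of its nonempty clusters, so that \<open>card P\<close> is the number of nonempty
  clusters; empty clusters do not contribute to the ratio-cut vector. At most one summand
  below is nonzero, because the clusters are pairwise disjoint.
\<close>

definition ratio_cut :: "('e::finite \<Rightarrow> nat \<times> nat) \<Rightarrow> nat set set \<Rightarrow> real ^ 'e" where
  "ratio_cut p P =
    (\<chi> e. \<Sum>C\<in>P. if fst (p e) \<in> C \<and> snd (p e) \<in> C then 1 / real (card C) else 0)"

definition RCut :: "('e::finite \<Rightarrow> nat \<times> nat) \<Rightarrow> nat \<Rightarrow> nat \<Rightarrow> (real ^ 'e) set" where
  "RCut p K n = convex hull {ratio_cut p P | P. partition_on {1..n} P \<and> card P \<le> K}"

definition RCut_eq :: "('e::finite \<Rightarrow> nat \<times> nat) \<Rightarrow> nat \<Rightarrow> nat \<Rightarrow> (real ^ 'e) set" where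
  "RCut_eq p K n = convex hull {ratio_cut p P | P. partition_on {1..n} P \<and> card P = K}"

text \<open>The inequality \<open>f X \<ge> b\<close> is valid for \<open>S\<close> and defines a facet of \<open>S\<close>.\<close>

definition defines_facet :: "('a::euclidean_space \<Rightarrow> real) \<Rightarrow> real \<Rightarrow> 'a set \<Rightarrow> bool" where
  "defines_facet f b S \<longleftrightarrow>
    (\<forall>X\<in>S. f X \<ge> b) \<and> aff_dim {X \<in> S. f X = b} = aff_dim S - 1"

text \<open>Every index type of the right cardinality admits such a labelling.\<close>

lemma card_pairs: "card (pairs n) = n choose 2"
proof -
  have "bij_betw (\<lambda>(i, j). {i, j}) (pairs n) {B. B \<subseteq> {1..n} \<and> card B = 2}"
    unfolding bij_betw_def
  proof
    show "inj_on (\<lambda>(i, j). {i, j}) (pairs n)"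
      by (auto simp: inj_on_def pairs_def doubleton_eq_iff)
    show "(\<lambda>(i, j). {i, j}) ` pairs n = {B. B \<subseteq> {1..n} \<and> card B = 2}"
    proof
      show "(\<lambda>(i, j). {i, j}) ` pairs n \<subseteq> {B. B \<subseteq> {1..n} \<and> card B = 2}"
        by (auto simp: pairs_def)
      show "{B. B \<subseteq> {1..n} \<and> card B = 2} \<subseteq> (\<lambda>(i, j). {i, j}) ` pairs n"
      proof
        fix B assume B: "B \<in> {B. B \<subseteq> {1..n} \<and> card B = 2}"
        then obtain x y where xy: "B = {x, y}" "x \<noteq> y"
          by (auto simp: card_2_iff)
        then have "(min x y, max x y) \<in> pairs n" "B = {min x y, max x y}"
          using B by (auto simp: pairs_def min_def max_def)
        then show "B \<in> (\<lambda>(i, j). {i, j}) ` pairs n"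
          by force
      qed
    qed
  qed
  then show ?thesis
    by (simp add: bij_betw_same_card n_subsets)
qed

lemma pair_labelling_exists:
  assumes "CARD('e::finite) = n choose 2" "2 \<le> n"
  shows "\<exists>p :: 'e \<Rightarrow> nat \<times> nat. pair_labelling n p"
proof -
  have "card (pairs n) > 0"
    using assms(2) by (simp add: card_pairs)
  then have "finite (pairs n)"
    using card_ge_0_finite by blast
  then show ?thesis
    unfolding pair_labelling_def
    using finite_same_card_bij[of "UNIV :: 'e set" "pairs n"] assms(1) card_pairs[of n] by simp
qed

end

theory Submission
  imports Defs
begin

text \<open>
  Fix an edge \<open>e\<close> with ends \<open>i\<close> and \<open>j\<close>. A ratio-cut vector satisfies \<open>X\<^sub>e = 0\<close> exactly when its
  partition separates \<open>i\<close> from \<open>j\<close>. Pairing a vector \<open>c\<close> with a ratio-cut vector gives the sum over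
  the clusters \<open>C\<close> of \<open>w(C) / |C|\<close>, where \<open>w(C)\<close> is the total \<open>c\<close>-weight of the edges inside \<open>C\<close>.
  Everything is computed from this formula; in particular \<open>c = 1\<close> shows that the entries of a
  ratio-cut vector with \<open>k\<close> clusters add up to \<open>(n - k) / 2\<close>.

  Three or more clusters (\<open>nonneg_defines_facet\<close>). By duality it suffices to find all pairs
  \<open>(c, d)\<close> such that \<open>c \<bullet> X = d\<close> on the face. Make a set of \<open>K - 2 \<ge> 1\<close> vertices containing \<open>i\<close>
  into singleton clusters, and split the remaining set \<open>W\<close> into two clusters in any way: \<open>i\<close> and
  \<open>j\<close> are then separated, so \<open>w(A) / |A| + w(W - A) / |W - A|\<close> is independent of \<open>A\<close>. Taking for
  \<open>A\<close> the one- and two-element sets forces all edges inside \<open>W\<close> to have the same weight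
  (\<open>edge_weights_eq_if_two_clusterings_const\<close>). Varying the singletons, and using \<open>j\<close> in place
  of \<open>i\<close>, one sees that \<open>c\<close> is constant off \<open>e\<close> (\<open>functional_const_off_edge\<close>). So \<open>c\<close> is a
  combination of the functional \<open>X\<^sub>e\<close> and the sum of all entries. For exactly \<open>K\<close> clusters the latter
  is constant on the polytope; for at most \<open>K\<close> clusters, comparing \<open>K\<close> with \<open>K - 1\<close> removes it.
  In both cases \<open>X\<^sub>e = 0\<close> is the only restriction that the face adds.

  Two clusters (\<open>nonneg_not_defines_facet\<close>). If only two clusters are available and \<open>i\<close>, \<open>j\<close> are
  separated, then any third vertex \<open>k\<close> lies with exactly one of them. Hence, in addition to
  \<open>X\<^sub>e = 0\<close>, the face satisfies the equation that \<open>X\<^sub>i\<^sub>k + X\<^sub>j\<^sub>k\<close> plus the sum of all entries at \<open>k\<close>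
  is \<open>1\<close>, because the row of \<open>k\<close> misses \<open>1\<close> by \<open>1 / |C|\<close>, where \<open>C\<close> is the cluster of \<open>k\<close>. Two
  partitions with \<open>i\<close> and \<open>j\<close> together show that this equation is independent of \<open>X\<^sub>e = 0\<close> on
  the polytope, so the face has codimension at least two.
\<close>

section \<open>Affine hulls and facets\<close>

text \<open>
  The component of \<open>x - a\<close> orthogonal to the directions of the affine hull is itself a functional
  that is constant on \<open>A\<close>, so it must be \<open>0\<close>.
\<close>

lemma mem_affine_hull_if_functionals:
  fixes x :: "'a::euclidean_space"
  assumes "A \<noteq> {}" and functionals: "\<And>c d. \<forall>y\<in>A. c \<bullet> y = d \<Longrightarrow> c \<bullet> x = d"
  shows "x \<in> affine hull A"
proof -
  obtain a where a: "a \<in> A" using assms(1) by blast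
  let ?V = "(\<lambda>y. - a + y) ` A"
  obtain v c where v: "v \<in> span ?V" and c: "\<And>w. w \<in> span ?V \<Longrightarrow> orthogonal c w"
    and x: "- a + x = v + c"
    using orthogonal_subspace_decomp_exists[of ?V "- a + x"] by metis
  have c_diff: "c \<bullet> y = c \<bullet> a" if "y \<in> A" for y
    using c[OF span_base[of "- a + y" ?V]] that by (simp add: orthogonal_def inner_diff_right)
  then have "c \<bullet> x = c \<bullet> a"
    using functionals[of c "c \<bullet> a"] by blast
  then have "c \<bullet> (- a + x) = 0" by (simp add: inner_diff_right)
  moreover have "c \<bullet> v = 0" using c[OF v] by (simp add: orthogonal_def)
  ultimately have "c \<bullet> c = 0" unfolding x inner_add_right by simp
  then have "x = a + v" using x by (simp add: algebra_simps)
  then show ?thesis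
    using v unfolding affine_hull_span_gen[OF hull_inc[OF a]] by blast
qed

text \<open>
  The dimension is never computed: adding the one generator \<open>z\<close> to the face raises the dimension
  by one, and the condition on functionals says that nothing more is needed to reach every generator.
\<close>

lemma defines_facetI:
  fixes f :: "'a::euclidean_space"
  assumes valid: "\<And>x. x \<in> G \<Longrightarrow> f \<bullet> x \<ge> b"
    and z: "z \<in> G" "f \<bullet> z \<noteq> b"
    and functionals: "\<And>c d x. \<lbrakk>\<forall>y\<in>G. f \<bullet> y = b \<longrightarrow> c \<bullet> y = d; c \<bullet> z = d; x \<in> G\<rbrakk> \<Longrightarrow> c \<bullet> x = d"
  shows "defines_facet (\<lambda>x. f \<bullet> x) b (convex hull G)"
proof -
  let ?S = "convex hull G"
  let ?F = "{x \<in> ?S. f \<bullet> x = b}"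
  have "?S \<subseteq> {x. f \<bullet> x \<ge> b}"
    by (rule hull_minimal) (use valid in \<open>auto simp: convex_halfspace_ge\<close>)
  then have valid_S: "\<forall>x\<in>?S. f \<bullet> x \<ge> b" by blast
  have "affine hull ?F \<subseteq> {x. f \<bullet> x = b}"
    by (rule hull_minimal) (auto simp: affine_hyperplane)
  then have "z \<notin> affine hull ?F" using z by blast
  then have dim: "aff_dim (insert z ?F) = aff_dim ?F + 1"
    by (simp add: aff_dim_insert)
  have "x \<in> affine hull (insert z ?F)" if "x \<in> G" for x
  proof (rule mem_affine_hull_if_functionals)
    fix c d assume *: "\<forall>y\<in>insert z ?F. c \<bullet> y = d"
    have "\<forall>y\<in>G. f \<bullet> y = b \<longrightarrow> c \<bullet> y = d"
      using * hull_inc[of _ G convex] by blast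
    then show "c \<bullet> x = d"
      using functionals * that by blast
  qed simp
  then have "?S \<subseteq> affine hull (insert z ?F)"
    by (intro hull_minimal) (auto simp: affine_imp_convex)
  then have "aff_dim ?S \<le> aff_dim (insert z ?F)"
    using aff_dim_subset aff_dim_affine_hull by metis
  moreover have "aff_dim (insert z ?F) \<le> aff_dim ?S"
    using z(1) by (intro aff_dim_subset) (auto simp: hull_inc)
  ultimately have "aff_dim ?F = aff_dim ?S - 1" using dim by linarith
  then show ?thesis
    using valid_S by (simp add: defines_facet_def)
qed

text \<open>
  A second affine equation \<open>l \<bullet> x = d\<close> that holds on the face, and whose independence of \<open>f \<bullet> x = b\<close>
  is witnessed by two generators, leaves room for two more dimensions. Testing the second equation
  on generators is enough, because a face of a convex hull is spanned by the generators in it.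
\<close>

lemma not_defines_facetI:
  fixes f l :: "'a::euclidean_space"
  assumes "finite G" and valid: "\<And>x. x \<in> G \<Longrightarrow> f \<bullet> x \<ge> b"
    and l: "\<And>x. \<lbrakk>x \<in> G; f \<bullet> x = b\<rbrakk> \<Longrightarrow> l \<bullet> x = d"
    and uv: "u \<in> G" "v \<in> G"
    and indep: "(f \<bullet> u - b) * (l \<bullet> v - d) \<noteq> (f \<bullet> v - b) * (l \<bullet> u - d)"
  shows "\<not> defines_facet (\<lambda>x. f \<bullet> x) b (convex hull G)"
proof -
  let ?S = "convex hull G"
  let ?F = "{x \<in> ?S. f \<bullet> x = b}"
  have "?S \<subseteq> {x. f \<bullet> x \<ge> b}"
    by (rule hull_minimal) (use valid in \<open>auto simp: convex_halfspace_ge\<close>)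
  then have "(?S \<inter> {x. f \<bullet> x = b}) face_of ?S"
    by (intro face_of_Int_supporting_hyperplane_ge) auto
  then obtain G' where G': "G' \<subseteq> G" and F: "?S \<inter> {x. f \<bullet> x = b} = convex hull G'"
    using face_of_convex_hull_subset[of G] \<open>finite G\<close> by (metis finite_imp_compact)
  have "f \<bullet> x = b" if "x \<in> G'" for x
    using hull_inc[OF that, of convex] F by blast
  then have "convex hull G' \<subseteq> {x. l \<bullet> x = d}"
    using G' by (intro hull_minimal) (auto simp: l convex_hyperplane)
  then have F_l: "l \<bullet> x = d" if "x \<in> ?F" for x
    using F that by blast
  \<comment> \<open>The functionals \<open>f - b\<close> and \<open>l - d\<close> both vanish on the face. As their values
    at \<open>u\<close> and \<open>v\<close> form a regular matrix, some \<open>y\<close> of \<open>u, v\<close> has \<open>f y \<noteq> b\<close>, and the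
    combination of the two functionals that also vanishes at \<open>y\<close> is nonzero at the other point.\<close>
  have key: "\<not> defines_facet (\<lambda>x. f \<bullet> x) b ?S"
    if "y \<in> G" "w \<in> G" "f \<bullet> y \<noteq> b"
      and ind: "(f \<bullet> y - b) * (l \<bullet> w - d) \<noteq> (f \<bullet> w - b) * (l \<bullet> y - d)" for y w
  proof -
    have "affine hull ?F \<subseteq> {x. f \<bullet> x = b}"
      by (rule hull_minimal) (auto simp: affine_hyperplane)
    then have "y \<notin> affine hull ?F" using that by blast
    then have 1: "aff_dim (insert y ?F) = aff_dim ?F + 1"
      by (simp add: aff_dim_insert)
    let ?m = "(f \<bullet> y - b) *\<^sub>R l - (l \<bullet> y - d) *\<^sub>R f"
    let ?r = "(f \<bullet> y - b) * d - (l \<bullet> y - d) * b"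
    have "affine hull (insert y ?F) \<subseteq> {x. ?m \<bullet> x = ?r}"
    proof (rule hull_minimal)
      show "insert y ?F \<subseteq> {x. ?m \<bullet> x = ?r}"
        using F_l by (auto simp: inner_diff_left algebra_simps)
    qed (rule affine_hyperplane)
    moreover have "?m \<bullet> w \<noteq> ?r"
      using ind by (auto simp: inner_diff_left algebra_simps)
    ultimately have "w \<notin> affine hull (insert y ?F)" by blast
    then have "aff_dim (insert w (insert y ?F)) = aff_dim ?F + 2"
      using 1 by (subst aff_dim_insert) simp
    moreover have "aff_dim (insert w (insert y ?F)) \<le> aff_dim ?S"
      using that by (intro aff_dim_subset) (auto simp: hull_inc)
    ultimately show ?thesis by (simp add: defines_facet_def)
  qed
  show ?thesis
  proof (cases "f \<bullet> u = b")
    case True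
    then have "f \<bullet> v \<noteq> b" using indep by auto
    then show ?thesis using key[of v u] uv indep by simp
  next
    case False
    then show ?thesis using key[of u v] uv indep by simp
  qed
qed

section \<open>Linear functionals as edge weights\<close>

text \<open>
  Unordered ends turn the indices into the two-element subsets of \<open>{1..n}\<close>, so no order on
  the vertices has to be respected below.
\<close>

definition ends :: "('e \<Rightarrow> nat \<times> nat) \<Rightarrow> 'e \<Rightarrow> nat set" where
  "ends p e = {fst (p e), snd (p e)}"

definition weight :: "('e::finite \<Rightarrow> nat \<times> nat) \<Rightarrow> real ^ 'e \<Rightarrow> nat set \<Rightarrow> real" where
  "weight p c C = (\<Sum>e | ends p e \<subseteq> C. c $ e)"

lemma bij_betw_ends:
  assumes "pair_labelling n p"
  shows "bij_betw (ends p) UNIV {B. B \<subseteq> {1..n} \<and> card B = 2}"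
proof -
  have "bij_betw (\<lambda>(i, j). {i, j}) (pairs n) {B. B \<subseteq> {1..n} \<and> card B = 2}"
    unfolding bij_betw_def
  proof
    show "inj_on (\<lambda>(i, j). {i, j}) (pairs n)"
      by (auto simp: inj_on_def pairs_def doubleton_eq_iff)
    have "B \<in> (\<lambda>(i, j). {i, j}) ` pairs n" if B: "B \<subseteq> {1..n}" "card B = 2" for B
    proof -
      obtain x y where "B = {x, y}" "x < y"
        using B(2) by (metis card_2_iff insert_commute nat_neq_iff)
      then show ?thesis
        using B(1) by (intro image_eqI[of _ _ "(x, y)"]) (auto simp: pairs_def)
    qed
    moreover have "(\<lambda>(i, j). {i, j}) ` pairs n \<subseteq> {B. B \<subseteq> {1..n} \<and> card B = 2}"
      by (auto simp: pairs_def)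
    ultimately show "(\<lambda>(i, j). {i, j}) ` pairs n = {B. B \<subseteq> {1..n} \<and> card B = 2}"
      by blast
  qed
  then have "bij_betw ((\<lambda>(i, j). {i, j}) \<circ> p) UNIV {B. B \<subseteq> {1..n} \<and> card B = 2}"
    using assms bij_betw_trans unfolding pair_labelling_def by blast
  moreover have "(\<lambda>(i, j). {i, j}) \<circ> p = ends p"
    by (auto simp: ends_def split_beta)
  ultimately show ?thesis by simp
qed

lemma ends_eq_iff:
  assumes "pair_labelling n p"
  shows "ends p e = ends p e' \<longleftrightarrow> e = e'"
  using bij_betw_imp_inj_on[OF bij_betw_ends[OF assms]] by (auto dest: injD)

lemma card_ends:
  assumes "pair_labelling n p"
  shows "card (ends p e) = 2"
  using bij_betw_imp_surj_on[OF bij_betw_ends[OF assms]] by auto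

lemma ends_cases:
  assumes "pair_labelling n p"
  obtains i j where "ends p e = {i, j}" "i \<noteq> j" "i \<in> {1..n}" "j \<in> {1..n}"
proof -
  have "ends p e \<subseteq> {1..n}" "card (ends p e) = 2"
    using bij_betw_imp_surj_on[OF bij_betw_ends[OF assms]] by auto
  then show ?thesis using that by (auto simp: card_2_iff)
qed

lemma ex_edge:
  assumes "pair_labelling n p" "i \<noteq> j" "i \<in> {1..n}" "j \<in> {1..n}"
  obtains e where "ends p e = {i, j}"
proof -
  have "{i, j} \<in> ends p ` UNIV"
    using assms(2-4) unfolding bij_betw_imp_surj_on[OF bij_betw_ends[OF assms(1)]]
    by simp
  then show ?thesis using that by (metis imageE)
qed

lemma ratio_cut_nth:
  "ratio_cut p P $ e = (\<Sum>C\<in>P. if ends p e \<subseteq> C then 1 / real (card C) else 0)"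
  by (simp add: ratio_cut_def ends_def)

lemma inner_ratio_cut:
  "c \<bullet> ratio_cut p P = (\<Sum>C\<in>P. weight p c C / real (card C))"
proof -
  have "c \<bullet> ratio_cut p P = (\<Sum>e\<in>UNIV. \<Sum>C\<in>P. if ends p e \<subseteq> C then c $ e / real (card C) else 0)"
    by (auto simp: inner_vec_def ratio_cut_nth sum_distrib_left intro!: sum.cong)
  also have "\<dots> = (\<Sum>C\<in>P. \<Sum>e\<in>UNIV. if ends p e \<subseteq> C then c $ e / real (card C) else 0)"
    by (rule sum.swap)
  also have "\<dots> = (\<Sum>C\<in>P. weight p c C / real (card C))"
    by (auto simp: weight_def sum_divide_distrib sum.If_cases)
  finally show ?thesis .
qed

lemma weight_add: "weight p (c + c') C = weight p c C + weight p c' C"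
  by (simp add: weight_def sum.distrib)

lemma weight_axis: "weight p (axis e 1) C = (if ends p e \<subseteq> C then 1 else 0)"
  by (simp add: weight_def axis_def)

text \<open>This allows edge weights to be written \<open>weight p c {x, y}\<close>, without naming an index.\<close>

lemma weight_ends:
  assumes "pair_labelling n p"
  shows "weight p c (ends p e) = c $ e"
proof -
  have "ends p e' \<subseteq> ends p e \<longleftrightarrow> e' = e" for e'
  proof
    assume sub: "ends p e' \<subseteq> ends p e"
    then have "ends p e' = ends p e"
      by (intro card_subset_eq) (simp_all add: card_ends[OF assms], simp add: ends_def)
    then show "e' = e" using ends_eq_iff[OF assms] by blast
  qed simp
  then show ?thesis by (simp add: weight_def)
qed

lemma weight_singleton:
  assumes "pair_labelling n p"
  shows "weight p c {x} = 0"
proof -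
  have "\<not> ends p e \<subseteq> {x}" for e
    by (rule ends_cases[OF assms, of e]) auto
  then show ?thesis by (simp add: weight_def)
qed

text \<open>
  Inclusion--exclusion over the edges meeting \<open>x\<close> or \<open>y\<close>: only the edge joining them is counted twice.
\<close>

lemma weight_diff_two:
  assumes p: "pair_labelling n p" and "x \<noteq> y" "x \<in> W" "y \<in> W"
  shows "weight p c (W - {x, y}) = weight p c (W - {x}) + weight p c (W - {y}) - weight p c W + weight p c {x, y}"
proof -
  have *: "weight p c C = (\<Sum>e\<in>UNIV. if ends p e \<subseteq> C then c $ e else 0)" for C
    by (simp add: weight_def sum.If_cases)
  have "(if ends p e \<subseteq> W - {x, y} then c $ e else 0) + (if ends p e \<subseteq> W then c $ e else 0) =
    (if ends p e \<subseteq> W - {x} then c $ e else 0) + (if ends p e \<subseteq> W - {y} then c $ e else 0)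
      + (if ends p e \<subseteq> {x, y} then c $ e else 0)" for e
    by (rule ends_cases[OF p, of e]) (use assms(2-4) in auto)
  then have "weight p c (W - {x, y}) + weight p c W =
      weight p c (W - {x}) + weight p c (W - {y}) + weight p c {x, y}"
    unfolding * sum.distrib[symmetric] by (intro sum.cong) auto
  then show ?thesis by simp
qed

lemma weight_1:
  assumes p: "pair_labelling n p" and "C \<subseteq> {1..n}"
  shows "weight p 1 C = real (card C choose 2)"
proof -
  have range: "range (ends p) = {B. B \<subseteq> {1..n} \<and> card B = 2}"
    by (rule bij_betw_imp_surj_on[OF bij_betw_ends[OF p]])
  have "ends p ` {e. ends p e \<subseteq> C} = range (ends p) \<inter> {B. B \<subseteq> C}" by blast
  also have "\<dots> = {B. B \<subseteq> C \<and> card B = 2}" using assms(2) unfolding range by blast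
  finally have "bij_betw (ends p) {e. ends p e \<subseteq> C} {B. B \<subseteq> C \<and> card B = 2}"
    by (intro bij_betw_subset[OF bij_betw_ends[OF p]]) auto
  then have "card {e. ends p e \<subseteq> C} = card {B. B \<subseteq> C \<and> card B = 2}"
    by (rule bij_betw_same_card)
  also have "\<dots> = card C choose 2"
    using finite_subset[OF assms(2)] by (simp add: n_subsets)
  finally show ?thesis by (simp add: weight_def)
qed

text \<open>As a functional this is the sum of all entries in the row of \<open>k\<close>.\<close>

definition star :: "('e::finite \<Rightarrow> nat \<times> nat) \<Rightarrow> nat \<Rightarrow> real ^ 'e" where
  "star p k = (\<chi> e. if k \<in> ends p e then 1 else 0)"

lemma weight_star:
  assumes p: "pair_labelling n p" and C: "C \<subseteq> {1..n}"
  shows "weight p (star p k) C = (if k \<in> C then real (card C) - 1 else 0)"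
proof (cases "k \<in> C")
  case True
  have fin: "finite C" using C finite_subset by blast
  have *: "weight p c C = (\<Sum>e\<in>UNIV. if ends p e \<subseteq> C then c $ e else 0)" for c C
    by (simp add: weight_def sum.If_cases)
  have "weight p (star p k) C + weight p 1 (C - {k}) = weight p 1 C"
    unfolding * sum.distrib[symmetric] by (intro sum.cong) (auto simp: star_def)
  moreover have "weight p 1 (C - {k}) = real (card (C - {k}) choose 2)"
    using C by (intro weight_1[OF p]) blast
  moreover have "card C = Suc (card (C - {k}))"
    using True fin by (metis card_Suc_Diff1)
  then have "real (card C choose 2) = real (card (C - {k})) + real (card (C - {k}) choose 2)"
    "real (card C) = real (card (C - {k})) + 1"
    by (simp_all add: numeral_2_eq_2)
  ultimately have "weight p (star p k) C = real (card C) - 1"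
    using weight_1[OF p C] by linarith
  then show ?thesis using True by simp
next
  case False
  then show ?thesis by (auto simp: weight_def star_def intro!: sum.neutral)
qed

section \<open>Ratio-cut vectors of particular partitions\<close>

lemma sum_partition_at:
  assumes "partition_on A P" "finite A" "C \<in> P" "k \<in> C"
  shows "(\<Sum>D\<in>P. if k \<in> D then g D else (0::real)) = g C"
proof -
  have "k \<in> D \<longleftrightarrow> D = C" if "D \<in> P" for D
    using assms that partition_onD2[OF assms(1)] unfolding disjoint_def by blast
  then have "(\<Sum>D\<in>P. if k \<in> D then g D else 0) = (\<Sum>D\<in>P. if D = C then g D else 0)"
    by (intro sum.cong) auto
  also have "\<dots> = g C"
    using assms(3) finite_elements[OF assms(2,1)] by simp
  finally show ?thesis .
qed

lemma ratio_cut_nth_cluster: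
  assumes "partition_on {1..n} P" "C \<in> P" "ends p e \<subseteq> C"
  shows "ratio_cut p P $ e = 1 / real (card C)"
proof -
  have C: "fst (p e) \<in> C" using assms(3) by (simp add: ends_def)
  have "ends p e \<subseteq> D \<longleftrightarrow> fst (p e) \<in> D" if "D \<in> P" for D
    using assms that C partition_onD2[OF assms(1)] unfolding disjoint_def ends_def by blast
  then have "ratio_cut p P $ e = (\<Sum>D\<in>P. if fst (p e) \<in> D then 1 / real (card D) else 0)"
    unfolding ratio_cut_nth by (intro sum.cong) auto
  then show ?thesis using sum_partition_at[OF assms(1) _ assms(2) C] by simp
qed

lemma ratio_cut_nonneg: "ratio_cut p P $ e \<ge> 0"
  unfolding ratio_cut_nth by (intro sum_nonneg) auto

lemma ratio_cut_nth_eq_0_iff: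
  assumes "partition_on {1..n} P"
  shows "ratio_cut p P $ e = 0 \<longleftrightarrow> (\<forall>C\<in>P. \<not> ends p e \<subseteq> C)"
proof -
  have "card C \<noteq> 0" if "C \<in> P" for C
    using that assms partition_onD1[OF assms] partition_onD3[OF assms]
    by (metis card_eq_0_iff finite_atLeastAtMost finite_subset Union_upper)
  then show ?thesis
    using ratio_cut_nth_cluster[OF assms, of _ p e] by (force simp: ratio_cut_nth)
qed

text \<open>
  A cluster of size \<open>s\<close> contributes \<open>s (s - 1) / 2\<close> entries \<open>1 / s\<close>, hence \<open>(s - 1) / 2\<close>, and the
  sizes add up to \<open>n\<close>.
\<close>

lemma sum_ratio_cut:
  assumes p: "pair_labelling n p" and P: "partition_on {1..n} P"
  shows "1 \<bullet> ratio_cut p P = (real n - real (card P)) / 2"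
proof -
  have C: "C \<subseteq> {1..n}" "finite C" "C \<noteq> {}" if "C \<in> P" for C
  proof -
    show "C \<subseteq> {1..n}" using that partition_onD1[OF P] by blast
    then show "finite C" using finite_subset by blast
    show "C \<noteq> {}" using that partition_onD3[OF P] by blast
  qed
  have "weight p 1 C / real (card C) = (real (card C) - 1) / 2" if "C \<in> P" for C
  proof -
    have "card C \<noteq> 0" using C[OF that] by simp
    moreover have "even (card C * (card C - 1))" by auto
    then have "real (card C choose 2) = real (card C) * (real (card C) - 1) / 2"
      using \<open>card C \<noteq> 0\<close> by (simp add: choose_two real_of_nat_div of_nat_diff)
    ultimately show ?thesis using weight_1[OF p C(1)[OF that]] by simp
  qed
  then have "1 \<bullet> ratio_cut p P = (\<Sum>C\<in>P. (real (card C) - 1) / 2)"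
    unfolding inner_ratio_cut by (rule sum.cong[OF refl])
  also have "\<dots> = (real (\<Sum>C\<in>P. card C) - real (card P)) / 2"
    by (simp add: sum_divide_distrib[symmetric] sum_subtractf)
  also have "(\<Sum>C\<in>P. card C) = n"
  proof -
    have "n = card (\<Union>P)" unfolding partition_onD1[OF P, symmetric] by simp
    also have "\<dots> = (\<Sum>C\<in>P. card C)"
      using C partition_onD2[OF P] by (intro card_Union_disjoint) auto
    finally show ?thesis ..
  qed
  finally show ?thesis .
qed

lemma singletons_Un_partition:
  assumes "finite V" "T \<subseteq> V" and Q: "partition_on (V - T) Q"
  shows "partition_on V ((\<lambda>x. {x}) ` T \<union> Q)"
    and "card ((\<lambda>x. {x}) ` T \<union> Q) = card T + card Q"
    and "(\<Sum>C\<in>(\<lambda>x. {x}) ` T \<union> Q. g C) = (\<Sum>x\<in>T. g {x}) + (\<Sum>C\<in>Q. g C)"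
proof -
  have disj: "(\<lambda>x. {x}) ` T \<inter> Q = {}" using Q by (auto simp: partition_on_def)
  have fin: "finite T" "finite Q"
    using assms finite_elements[OF _ Q] by (auto intro: finite_subset)
  have inj: "inj_on (\<lambda>x. {x}) T" by (auto simp: inj_on_def)
  show "partition_on V ((\<lambda>x. {x}) ` T \<union> Q)"
  proof (rule partition_onI)
    show "\<Union> ((\<lambda>x. {x}) ` T \<union> Q) = V" "{} \<notin> (\<lambda>x. {x}) ` T \<union> Q"
      using assms by (auto simp: partition_on_def)
  next
    fix C D assume "C \<in> (\<lambda>x. {x}) ` T \<union> Q" "D \<in> (\<lambda>x. {x}) ` T \<union> Q" "C \<noteq> D"
    moreover have "disjnt C D" if "C \<in> Q" "D \<in> Q" "C \<noteq> D" for C D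
      using that Q by (auto simp: partition_on_def pairwise_def)
    ultimately show "disjnt C D"
      using partition_onD1[OF Q] by (auto simp: disjnt_def)
  qed
  show "card ((\<lambda>x. {x}) ` T \<union> Q) = card T + card Q"
    using disj fin inj by (simp add: card_Un_disjoint card_image)
  show "(\<Sum>C\<in>(\<lambda>x. {x}) ` T \<union> Q. g C) = (\<Sum>x\<in>T. g {x}) + (\<Sum>C\<in>Q. g C)"
    using disj fin inj by (simp add: sum.union_disjoint sum.reindex)
qed

lemma partition_on_two:
  assumes "A \<subseteq> W" "A \<noteq> {}" "A \<noteq> W"
  shows "partition_on W {A, W - A}" "card {A, W - A} = 2"
    "(\<Sum>C\<in>{A, W - A}. g C) = g A + g (W - A)"
proof -
  have "A \<noteq> W - A" using assms by blast
  then show "card {A, W - A} = 2" "(\<Sum>C\<in>{A, W - A}. g C) = g A + g (W - A)" by auto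
  show "partition_on W {A, W - A}"
    using assms by (auto simp: partition_on_def disjoint_def)
qed

lemma ex_partition_separating:
  assumes "i \<noteq> j" "i \<in> {1..n}" "j \<in> {1..n}" "2 \<le> k" "k \<le> n"
  obtains P where "partition_on {1..n} P" "card P = k" "\<forall>C\<in>P. \<not> {i, j} \<subseteq> C"
proof -
  have "k - 2 \<le> card ({1..n} - {i, j})" using assms by simp
  then obtain T where T: "T \<subseteq> {1..n} - {i, j}" "card T = k - 2"
    by (meson obtain_subset_with_card_n)
  let ?W = "{1..n} - T"
  let ?Q = "{{i}, ?W - {i}}"
  have "{i} \<subseteq> ?W" "{i} \<noteq> {}" "j \<in> ?W - {i}" using assms(1-3) T(1) by blast+
  then have "{i} \<subseteq> ?W" "{i} \<noteq> {}" "{i} \<noteq> ?W" by blast+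
  note Q = partition_on_two[OF this]
  have "T \<subseteq> {1..n}" using T by blast
  note P = singletons_Un_partition[OF _ this Q(1)]
  show ?thesis
  proof
    show "partition_on {1..n} ((\<lambda>x. {x}) ` T \<union> ?Q)" using P(1) by simp
    show "card ((\<lambda>x. {x}) ` T \<union> ?Q) = k" using P(2) T(2) assms(4) unfolding Q(2) by simp
    show "\<forall>C\<in>(\<lambda>x. {x}) ` T \<union> ?Q. \<not> {i, j} \<subseteq> C" using assms(1) by auto
  qed
qed

lemma ex_partition_joining:
  assumes "i \<noteq> j" "i \<in> {1..n}" "j \<in> {1..n}" "1 \<le> k" "k < n"
  obtains P where "partition_on {1..n} P" "card P = k" "\<exists>C\<in>P. {i, j} \<subseteq> C"
proof -
  have "k - 1 \<le> card ({1..n} - {i, j})" using assms by simp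
  then obtain T where T: "T \<subseteq> {1..n} - {i, j}" "card T = k - 1"
    by (meson obtain_subset_with_card_n)
  let ?W = "{1..n} - T"
  have W: "{i, j} \<subseteq> ?W" using T assms(2,3) by blast
  then have Q: "partition_on ?W {?W}" by (intro partition_on_space) blast
  have "T \<subseteq> {1..n}" using T by blast
  note P = singletons_Un_partition[OF _ this Q]
  show ?thesis
  proof
    show "partition_on {1..n} ((\<lambda>x. {x}) ` T \<union> {?W})" using P(1) by simp
    show "card ((\<lambda>x. {x}) ` T \<union> {?W}) = k" using P(2) T(2) assms(4) by simp
    show "\<exists>C\<in>(\<lambda>x. {x}) ` T \<union> {?W}. {i, j} \<subseteq> C" using W by blast
  qed
qed

section \<open>At least three clusters\<close>

text \<open>
  With \<open>N = |W|\<close>, splitting off \<open>{x}\<close> shows that the weight of \<open>W - {x}\<close> is \<open>(N - 1) d\<close> for every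
  \<open>x\<close>. By inclusion--exclusion the weight of \<open>W - {x, y}\<close> is then the weight of \<open>{x, y}\<close> up to a
  constant, so splitting off \<open>{x, y}\<close> yields an equation for the weight of \<open>{x, y}\<close> whose
  coefficients do not depend on \<open>x\<close> and \<open>y\<close>.
\<close>

lemma edge_weights_eq_if_two_clusterings_const:
  assumes p: "pair_labelling n p" and W: "finite W" "3 \<le> card W"
    and const: "\<And>A. \<lbrakk>A \<subseteq> W; A \<noteq> {}; A \<noteq> W\<rbrakk> \<Longrightarrow>
      weight p c A / real (card A) + weight p c (W - A) / real (card (W - A)) = d"
    and "x \<noteq> y" "x \<in> W" "y \<in> W" "u \<noteq> v" "u \<in> W" "v \<in> W"
  shows "weight p c {x, y} = weight p c {u, v}"
proof -
  define N where "N = real (card W)"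
  have N: "N \<ge> 3" using W(2) by (simp add: N_def)
  have del1: "weight p c (W - {x}) = (N - 1) * d" if "x \<in> W" for x
  proof -
    have "{x} \<noteq> W" using W(2) by auto
    moreover have "real (card (W - {x})) = N - 1"
      using that W by (simp add: N_def of_nat_diff)
    ultimately have "weight p c (W - {x}) / (N - 1) = d"
      using const[of "{x}"] that by (simp add: weight_singleton[OF p])
    then show ?thesis using N by (simp add: field_simps)
  qed
  have pair: "weight p c {x, y} * N = 2 * ((N - 2) * d - 2 * (N - 1) * d + weight p c W)"
    if "x \<noteq> y" "x \<in> W" "y \<in> W" for x y
  proof -
    have "{x, y} \<noteq> W" using W(2) that by auto
    moreover have "real (card (W - {x, y})) = N - 2"
      using that W by (simp add: N_def of_nat_diff card_Diff_subset)
    ultimately have "weight p c {x, y} / 2 + weight p c (W - {x, y}) / (N - 2) = d"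
      using const[of "{x, y}"] that by simp
    then have "weight p c {x, y} * (N - 2) + 2 * weight p c (W - {x, y}) = 2 * (N - 2) * d"
      using N by (simp add: field_simps)
    then show ?thesis
      using that by (simp add: weight_diff_two[OF p] del1 algebra_simps)
  qed
  have "weight p c {x, y} * N = weight p c {u, v} * N"
    using pair[of x y] pair[of u v] assms by simp
  then show ?thesis using N by simp
qed

text \<open>
  Two adjacent edges that avoid an end \<open>i\<close> of \<open>e\<close> fit into a common set \<open>W\<close> whose complement consists of
  \<open>K - 2\<close> vertices, one of them \<open>i\<close>. As \<open>i\<close> forms a cluster of its own, the two-clusterings of
  \<open>W\<close> are unrestricted and the previous lemma applies. Chains of adjacent edges then compare all
  edges avoiding \<open>i\<close>, and likewise all edges avoiding the other end; an edge avoiding both ends,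
  which exists because \<open>n \<ge> 4\<close>, links the two families. Only \<open>e\<close> avoids neither end.
\<close>

lemma functional_const_off_edge:
  assumes p: "pair_labelling n p" and K: "3 \<le> K" "K < n"
    and const: "\<And>P. \<lbrakk>partition_on {1..n} P; card P = K; ratio_cut p P $ e = 0\<rbrakk> \<Longrightarrow>
      c \<bullet> ratio_cut p P = d"
  obtains m where "\<And>e'. e' \<noteq> e \<Longrightarrow> c $ e' = m"
proof -
  have adjacent: "weight p c {x, y} = weight p c {y, z}"
    if i: "i \<in> ends p e" and xyz: "x \<noteq> y" "y \<noteq> z" "x \<in> {1..n} - {i}" "y \<in> {1..n} - {i}" "z \<in> {1..n} - {i}"
    for i x y z
  proof (cases "x = z")
    case False
    obtain j where j: "ends p e = {i, j}" "i \<noteq> j" "i \<in> {1..n}"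
      using i by (rule_tac ends_cases[OF p, of e]) auto
    have "card ({1..n} - {i, x, y, z}) = n - 4"
      using xyz False j(3) by (subst card_Diff_subset) auto
    then have "K - 3 \<le> card ({1..n} - {i, x, y, z})" using K by simp
    then obtain T' where T': "T' \<subseteq> {1..n} - {i, x, y, z}" "card T' = K - 3" "finite T'"
      by (meson obtain_subset_with_card_n)
    define T where "T = insert i T'"
    have "i \<notin> T'" using T' by blast
    then have T: "T \<subseteq> {1..n}" "card T = K - 2" "finite T" "i \<in> T"
      using T' j K by (auto simp: T_def)
    define W where "W = {1..n} - T"
    have W: "finite W" "x \<in> W" "y \<in> W" "z \<in> W"
      using xyz T' by (auto simp: W_def T_def)
    have "card W = n - (K - 2)" using T by (simp add: W_def card_Diff_subset)
    then have card_W: "3 \<le> card W" using K by linarith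
    have "weight p c A / real (card A) + weight p c (W - A) / real (card (W - A)) = d"
      if A: "A \<subseteq> W" "A \<noteq> {}" "A \<noteq> W" for A
    proof -
      let ?Q = "{A, W - A}"
      let ?P = "(\<lambda>x. {x}) ` T \<union> ?Q"
      note Q = partition_on_two[OF A]
      have P: "partition_on {1..n} ?P" "card ?P = card T + card ?Q"
        and sum_P: "(\<Sum>C\<in>?P. g C) = (\<Sum>x\<in>T. g {x}) + (\<Sum>C\<in>?Q. g C)" for g :: "nat set \<Rightarrow> real"
        using singletons_Un_partition[OF _ T(1), of ?Q] Q(1) by (simp_all add: W_def)
      have "card ?P = K" using P(2) Q(2) T(2) K by simp
      moreover have "ratio_cut p ?P $ e = 0"
        unfolding ratio_cut_nth_eq_0_iff[OF P(1)] using A(1) j T(4) by (auto simp: W_def)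
      ultimately have "c \<bullet> ratio_cut p ?P = d" using const P(1) by blast
      then show ?thesis
        unfolding inner_ratio_cut sum_P Q(3) by (simp add: weight_singleton[OF p])
    qed
    then show ?thesis
      using xyz(1,2) W card_W by (intro edge_weights_eq_if_two_clusterings_const[OF p W(1)]) auto
  qed (simp add: insert_commute)
  have avoiding: "weight p c {x, y} = weight p c {u, v}"
    if i: "i \<in> ends p e" and "x \<noteq> y" "u \<noteq> v" "{x, y, u, v} \<subseteq> {1..n} - {i}"
    for i x y u v
  proof (cases "y = u")
    case False
    then have "weight p c {x, y} = weight p c {y, u}" "weight p c {y, u} = weight p c {u, v}"
      using that by (auto intro!: adjacent[OF i])
    then show ?thesis by simp
  qed (use that in \<open>auto intro!: adjacent[OF i]\<close>)
  obtain i j where ij: "ends p e = {i, j}" "i \<noteq> j" "i \<in> {1..n}" "j \<in> {1..n}"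
    by (rule ends_cases[OF p])
  \<comment> \<open>The edge \<open>{r, s}\<close> belongs to both families, those avoiding \<open>i\<close> and those avoiding \<open>j\<close>.\<close>
  have "2 \<le> card ({1..n} - {i, j})" using K ij by simp
  then obtain R where "R \<subseteq> {1..n} - {i, j}" "card R = 2"
    by (meson obtain_subset_with_card_n)
  then obtain r s where rs: "r \<noteq> s" "{r, s} \<subseteq> {1..n} - {i, j}" by (auto simp: card_2_iff)
  show ?thesis
  proof
    fix e' assume "e' \<noteq> e"
    obtain x y where xy: "ends p e' = {x, y}" "x \<noteq> y" "x \<in> {1..n}" "y \<in> {1..n}"
      by (rule ends_cases[OF p])
    have "{x, y} \<noteq> {i, j}" using ends_eq_iff[OF p, of e' e] \<open>e' \<noteq> e\<close> xy(1) ij(1) by simp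
    then have "i \<notin> {x, y} \<or> j \<notin> {x, y}" using ij(2) by blast
    then obtain q where q: "q \<in> {i, j}" "q \<notin> {x, y}" by blast
    have "weight p c {x, y} = weight p c {r, s}"
      by (rule avoiding[of q]) (use q ij(1) xy rs in auto)
    then show "c $ e' = weight p c {r, s}"
      using weight_ends[OF p, of c e'] xy(1) by simp
  qed
qed

text \<open>
  Keeping the set \<open>N\<close> of allowed numbers of clusters general treats both polytopes at once:
  \<open>{..K}\<close> gives the one, \<open>{K}\<close> the other.
\<close>

definition cuts :: "('e::finite \<Rightarrow> nat \<times> nat) \<Rightarrow> nat \<Rightarrow> nat set \<Rightarrow> (real ^ 'e) set" where
  "cuts p n N = {ratio_cut p P | P. partition_on {1..n} P \<and> card P \<in> N}"

lemma nth_eq_inner_axis: "(\<lambda>X. X $ e) = (\<lambda>X::real ^ 'e::finite. axis e 1 \<bullet> X)"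
  by (simp add: inner_axis')

text \<open>
  If \<open>N = {K}\<close>, the sum of the entries is constant on the polytope. If a second number \<open>k\<close> of
  clusters is allowed, separating partitions with \<open>k\<close> and with \<open>K\<close> clusters have different sums,
  so the sum cannot occur in an equation of the face. The bound \<open>2 \<le> k\<close> is what a
  separating partition requires.
\<close>

lemma nonneg_defines_facet:
  assumes p: "pair_labelling n p" and K: "3 \<le> K" "K < n" "K \<in> N"
    and N: "N = {K} \<or> (\<exists>k\<in>N. k \<noteq> K \<and> 2 \<le> k \<and> k \<le> n)"
  shows "defines_facet (\<lambda>X. X $ e) 0 (convex hull cuts p n N)"
proof -
  obtain i j where ij: "ends p e = {i, j}" "i \<noteq> j" "i \<in> {1..n}" "j \<in> {1..n}"
    by (rule ends_cases[OF p])
  obtain Z where Z: "partition_on {1..n} Z" "card Z = K" "\<exists>C\<in>Z. {i, j} \<subseteq> C"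
  proof (rule ex_partition_joining[OF ij(2-4)])
    show "1 \<le> K" "K < n" using K by simp_all
  qed
  let ?z = "ratio_cut p Z"
  have z0: "?z $ e \<noteq> 0" using Z(3) unfolding ratio_cut_nth_eq_0_iff[OF Z(1)] ij(1) by blast
  have separated: "\<exists>P. partition_on {1..n} P \<and> card P = k \<and> ratio_cut p P $ e = 0"
    if k: "2 \<le> k" "k \<le> n" for k
  proof -
    obtain P where P: "partition_on {1..n} P" "card P = k" "\<forall>C\<in>P. \<not> {i, j} \<subseteq> C"
      using ex_partition_separating[OF ij(2-4) k] by blast
    then show ?thesis using ratio_cut_nth_eq_0_iff[OF P(1), of p e] ij(1) by auto
  qed
  show ?thesis
    unfolding nth_eq_inner_axis
  proof (rule defines_facetI)
    show "axis e 1 \<bullet> x \<ge> 0" if "x \<in> cuts p n N" for x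
      using that by (auto simp: cuts_def inner_axis' ratio_cut_nonneg)
    show "?z \<in> cuts p n N" using Z K(3) by (auto simp: cuts_def)
    show "axis e 1 \<bullet> ?z \<noteq> 0" using z0 by (simp add: inner_axis')
  next
    fix c d x
    assume face: "\<forall>y\<in>cuts p n N. axis e 1 \<bullet> y = 0 \<longrightarrow> c \<bullet> y = d"
      and z: "c \<bullet> ?z = d" and x: "x \<in> cuts p n N"
    have face_P: "c \<bullet> ratio_cut p P = d"
      if "partition_on {1..n} P" "card P \<in> N" "ratio_cut p P $ e = 0" for P
      using face that by (auto simp: cuts_def inner_axis')
    obtain m where m: "\<And>e'. e' \<noteq> e \<Longrightarrow> c $ e' = m"
      using functional_const_off_edge[OF p K(1,2), of e c d] face_P K(3) by blast
    \<comment> \<open>So \<open>c\<close> combines the sum of all entries and the entry at \<open>e\<close>.\<close>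
    have "c = m *\<^sub>R 1 + (c $ e - m) *\<^sub>R axis e 1"
      using m by (auto simp: vec_eq_iff axis_def)
    then have "c \<bullet> X = m * (1 \<bullet> X) + (c $ e - m) * X $ e" for X
      by (metis inner_add_left inner_scaleR_left inner_axis' inner_real_def mult_1)
    then have c_P: "c \<bullet> ratio_cut p P = m * ((real n - real (card P)) / 2) + (c $ e - m) * ratio_cut p P $ e"
      if "partition_on {1..n} P" for P
      using sum_ratio_cut[OF p that] by simp
    have d: "d = m * ((real n - real k) / 2)" if "k \<in> N" "2 \<le> k" "k \<le> n" for k
      using separated[OF that(2,3)] face_P c_P that(1) by force
    have d_K: "d = m * ((real n - real K) / 2)" using d[of K] K by simp
    \<comment> \<open>Since \<open>i\<close> and \<open>j\<close> share a cluster of \<open>Z\<close>, the value at \<open>Z\<close> determines the coefficient of \<open>X\<^sub>e\<close>.\<close>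
    then have m_e: "c $ e = m" using c_P[OF Z(1)] z z0 Z(2) by simp
    obtain P where P: "x = ratio_cut p P" "partition_on {1..n} P" "card P \<in> N"
      using x by (auto simp: cuts_def)
    from N show "c \<bullet> x = d"
    proof
      assume "N = {K}"
      then show ?thesis using c_P[OF P(2)] P m_e d_K by simp
    next
      assume "\<exists>k\<in>N. k \<noteq> K \<and> 2 \<le> k \<and> k \<le> n"
      then obtain k where "k \<in> N" "k \<noteq> K" "2 \<le> k" "k \<le> n" by blast
      then have "m * ((real n - real k) / 2) = m * ((real n - real K) / 2)" "k \<noteq> K"
        using d[of k] d_K by auto
      then have "m = 0" by simp
      then show ?thesis using c_P[OF P(2)] P m_e d_K by simp
    qed
  qed
qed

section \<open>Two clusters\<close>

text \<open>
  The second equation is \<open>l \<bullet> X = 1\<close>, where \<open>l\<close> adds up the row of a third vertex \<open>k\<close>, counting the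
  entries at \<open>{i, k}\<close> and \<open>{j, k}\<close> twice. The witness partitions must keep \<open>i\<close> and \<open>j\<close> together, once
  without \<open>k\<close>, giving \<open>l \<bullet> X < 1\<close>, and once with \<open>k\<close>, giving \<open>l \<bullet> X > 1\<close>. The second one is
  \<open>{i, j, k}\<close> and its complement if there is a fourth vertex, and a single cluster otherwise; for
  \<open>n = 3\<close> with exactly two clusters neither is possible, and the inequality does define a facet.
\<close>

lemma nonneg_not_defines_facet:
  assumes p: "pair_labelling n p" and n: "3 \<le> n" "4 \<le> n \<or> 1 \<in> N"
    and N: "N \<subseteq> {..2}" "2 \<in> N"
  shows "\<not> defines_facet (\<lambda>X. X $ e) 0 (convex hull cuts p n N)"
proof -
  obtain i j where ij: "ends p e = {i, j}" "i \<noteq> j" "i \<in> {1..n}" "j \<in> {1..n}"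
    by (rule ends_cases[OF p])
  have "{1..n} - {i, j} \<noteq> {}"
  proof
    assume "{1..n} - {i, j} = {}"
    then have "card {1..n} \<le> card {i, j}" by (intro card_mono) auto
    then show False using n ij by simp
  qed
  then obtain k where k: "k \<in> {1..n}" "k \<noteq> i" "k \<noteq> j" by blast
  obtain e1 where e1: "ends p e1 = {i, k}" using ex_edge[OF p, of i k] ij k by metis
  obtain e2 where e2: "ends p e2 = {j, k}" using ex_edge[OF p, of j k] ij k by metis
  define l where "l = star p k + axis e1 1 + axis e2 1"
  have l_P: "l \<bullet> ratio_cut p P = (real (card C) - 1 + of_bool (i \<in> C) + of_bool (j \<in> C)) / real (card C)"
    if P: "partition_on {1..n} P" and C: "C \<in> P" "k \<in> C" for P C
  proof -
    have "weight p l D = (if k \<in> D then real (card D) - 1 + of_bool (i \<in> D) + of_bool (j \<in> D) else 0)"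
      if "D \<in> P" for D
    proof -
      have "D \<subseteq> {1..n}" using partition_onD1[OF P] that by blast
      then show ?thesis by (simp add: l_def weight_add weight_axis weight_star[OF p] e1 e2)
    qed
    then have "l \<bullet> ratio_cut p P = (\<Sum>D\<in>P. if k \<in> D then
        (real (card D) - 1 + of_bool (i \<in> D) + of_bool (j \<in> D)) / real (card D) else 0)"
      unfolding inner_ratio_cut by (intro sum.cong) auto
    then show ?thesis using sum_partition_at[OF P _ C] by simp
  qed
  let ?A = "{i, j}"
  let ?U = "{?A, {1..n} - ?A}"
  have A: "?A \<subseteq> {1..n}" "?A \<noteq> {}" "?A \<noteq> {1..n}" using ij k by blast+
  have card_rest: "real (card ({1..n} - ?A)) = real n - 2"
    using ij n by (simp add: of_nat_diff)
  have u: "ratio_cut p ?U \<in> cuts p n N"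
    using partition_on_two[OF A] N(2) by (auto simp: cuts_def)
  have u_e: "ratio_cut p ?U $ e = 1 / 2"
    using ratio_cut_nth_cluster[OF partition_on_two(1)[OF A], of ?A p e] ij by simp
  have u_l: "l \<bullet> ratio_cut p ?U = (real n - 3) / (real n - 2)"
    using l_P[OF partition_on_two(1)[OF A], of "{1..n} - ?A"] k card_rest by simp
  have "\<exists>V B. partition_on {1..n} V \<and> card V \<in> N \<and> B \<in> V \<and> {i, j, k} \<subseteq> B"
    using n(2)
  proof
    assume "1 \<in> N"
    then show ?thesis
      using partition_on_space[of "{1..n}"] n ij k
      by (intro exI[of _ "{{1..n}}"] exI[of _ "{1..n}"]) auto
  next
    assume "4 \<le> n"
    have ijk: "{i, j, k} \<subseteq> {1..n}" "{i, j, k} \<noteq> {}" using ij k by blast+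
    have "card {i, j, k} \<noteq> card {1..n}" using \<open>4 \<le> n\<close> ij k by simp
    then have "{i, j, k} \<noteq> {1..n}" by metis
    note Q = partition_on_two[OF ijk this]
    show ?thesis
    proof (intro exI[of _ "{{i, j, k}, {1..n} - {i, j, k}}"] exI[of _ "{i, j, k}"] conjI)
      show "partition_on {1..n} {{i, j, k}, {1..n} - {i, j, k}}" by (rule Q(1))
      show "card {{i, j, k}, {1..n} - {i, j, k}} \<in> N" unfolding Q(2) by (rule N(2))
    qed simp_all
  qed
  then obtain V B where V: "partition_on {1..n} V" "card V \<in> N" "B \<in> V" "{i, j, k} \<subseteq> B"
    by blast
  have v: "ratio_cut p V \<in> cuts p n N" using V by (auto simp: cuts_def)
  have v_e: "ratio_cut p V $ e = 1 / real (card B)"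
    using ratio_cut_nth_cluster[OF V(1,3), of p e] V(4) ij by simp
  have "B \<subseteq> {1..n}" using partition_onD1[OF V(1)] V(3) by blast
  then have B: "real (card B) > 0"
    using V(4) by (auto simp: card_gt_0_iff intro: finite_subset)
  have v_l: "l \<bullet> ratio_cut p V = (real (card B) + 1) / real (card B)"
    using l_P[OF V(1,3)] V(4) by simp
  show ?thesis
    unfolding nth_eq_inner_axis
  proof (rule not_defines_facetI)
    have "cuts p n N \<subseteq> ratio_cut p ` {P. partition_on {1..n} P}" by (auto simp: cuts_def)
    then show "finite (cuts p n N)"
      using finitely_many_partition_on[of "{1..n}"] by (auto intro: finite_subset)
    show "axis e 1 \<bullet> x \<ge> 0" if "x \<in> cuts p n N" for x
      using that by (auto simp: cuts_def inner_axis' ratio_cut_nonneg)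
    show "l \<bullet> x = 1" if x: "x \<in> cuts p n N" "axis e 1 \<bullet> x = 0" for x
    proof -
      obtain P where P: "x = ratio_cut p P" "partition_on {1..n} P" "card P \<le> 2"
        using x(1) N(1) by (auto simp: cuts_def)
      have sep: "\<not> {i, j} \<subseteq> C" if "C \<in> P" for C
        using x(2) that ratio_cut_nth_eq_0_iff[OF P(2), of p e] ij(1) P(1)
        by (simp add: inner_axis')
      have fin: "finite P" using finite_elements[OF _ P(2)] by simp
      obtain C where C: "C \<in> P" "k \<in> C" using partition_onD1[OF P(2)] k(1) by blast
      obtain I J where IJ: "I \<in> P" "i \<in> I" "J \<in> P" "j \<in> J"
        using partition_onD1[OF P(2)] ij by blast
      have "C = I \<or> C = J"
      proof (rule ccontr)
        assume "\<not> (C = I \<or> C = J)"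
        moreover have "I \<noteq> J" using sep IJ by blast
        ultimately have "card {C, I, J} = 3" by simp
        moreover have "card {C, I, J} \<le> card P" using fin C IJ by (intro card_mono) auto
        ultimately show False using P(3) by simp
      qed
      then have one: "of_bool (i \<in> C) + of_bool (j \<in> C) = (1::real)"
        using IJ sep[OF C(1)] by auto
      have "C \<subseteq> {1..n}" using partition_onD1[OF P(2)] C(1) by blast
      then have "real (card C) > 0"
        using C(2) by (auto simp: card_gt_0_iff intro: finite_subset)
      then show ?thesis using l_P[OF P(2) C] one P(1) by simp
    qed
    show "(axis e 1 \<bullet> ratio_cut p ?U - 0) * (l \<bullet> ratio_cut p V - 1)
      \<noteq> (axis e 1 \<bullet> ratio_cut p V - 0) * (l \<bullet> ratio_cut p ?U - 1)"
    proof -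
      have "(axis e 1 \<bullet> ratio_cut p ?U - 0) * (l \<bullet> ratio_cut p V - 1) > 0"
        unfolding inner_axis' u_e v_l using B by (simp add: field_simps)
      moreover have "(axis e 1 \<bullet> ratio_cut p V - 0) * (l \<bullet> ratio_cut p ?U - 1) < 0"
        unfolding inner_axis' v_e u_l using B n by (simp add: field_simps)
      ultimately show ?thesis by linarith
    qed
  qed (use u v in auto)
qed

section \<open>The two ratio-cut polytopes\<close>

lemma RCut_eq_hull_cuts:
  "RCut p K n = convex hull cuts p n {..K}" "RCut_eq p K n = convex hull cuts p n {K}"
  by (simp_all add: RCut_def RCut_eq_def cuts_def)

theorem proposition4:
  fixes n K :: nat and p :: "'e::finite \<Rightarrow> nat \<times> nat"
  assumes "pair_labelling n p"
  shows "(3 \<le> n \<and> 2 \<le> K \<and> K \<le> n - 1 \<longrightarrow>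
            (\<forall>e. defines_facet (\<lambda>X. X $ e) 0 (RCut p K n) \<longleftrightarrow> 3 \<le> K))
       \<and> (4 \<le> n \<and> 2 \<le> K \<and> K \<le> n - 1 \<longrightarrow>
            (\<forall>e. defines_facet (\<lambda>X. X $ e) 0 (RCut_eq p K n) \<longleftrightarrow> 3 \<le> K))"
proof (intro conjI impI allI)
  fix e assume K: "3 \<le> n \<and> 2 \<le> K \<and> K \<le> n - 1"
  have "defines_facet (\<lambda>X. X $ e) 0 (RCut p K n)" if "3 \<le> K"
    unfolding RCut_eq_hull_cuts
    by (rule nonneg_defines_facet[OF assms that]) (use K that in \<open>auto intro: bexI[of _ "K - 1"]\<close>)
  moreover have "\<not> defines_facet (\<lambda>X. X $ e) 0 (RCut p K n)" if "\<not> 3 \<le> K"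
    unfolding RCut_eq_hull_cuts
    by (rule nonneg_not_defines_facet[OF assms]) (use K that in auto)
  ultimately show "defines_facet (\<lambda>X. X $ e) 0 (RCut p K n) \<longleftrightarrow> 3 \<le> K" by blast
next
  fix e assume K: "4 \<le> n \<and> 2 \<le> K \<and> K \<le> n - 1"
  have "defines_facet (\<lambda>X. X $ e) 0 (RCut_eq p K n)" if "3 \<le> K"
    unfolding RCut_eq_hull_cuts
    by (rule nonneg_defines_facet[OF assms that]) (use K in auto)
  moreover have "\<not> defines_facet (\<lambda>X. X $ e) 0 (RCut_eq p K n)" if "\<not> 3 \<le> K"
    unfolding RCut_eq_hull_cuts
    by (rule nonneg_not_defines_facet[OF assms]) (use K that in auto)
  ultimately show "defines_facet (\<lambda>X. X $ e) 0 (RCut_eq p K n) \<longleftrightarrow> 3 \<le> K" by blast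
qed

end
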